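(* Let $\Phi$ be a nice Young function such that $\alpha_\Phi^\infty > 2$, and let $S\subset\mathbb{Z}$ be a $\Lambda(\Phi)$-set. Then there is a constant $C>0$, independent of $N$, such that for every integer $N\ge 1$, $$|S\cap[-N,N]|\le C\,(\Phi^{-1}(N))^2 .$$
   Context: $\mathbb{T}=\mathbb{R}/\mathbb{Z}$ with Lebesgue measure $dx$; $|A|$ is the number of elements of a finite set $A$. A Young function is a convex $\Phi:[0,\infty)\to[0,\infty]$ with $\Phi(0)=0$ and $\lim_{u\to\infty}\Phi(u)=+\infty$. It is a nice Young function ($N$-function) if it is finite-valued and continuous, $\Phi(u)=0$ if and only if $u=0$, $\lim_{u\to0}\Phi(u)/u=0$ and $\lim_{u\to\infty}\Phi(u)/u=+\infty$. $\Phi^{-1}$ is its inverse function. The Orlicz (Luxemburg) norm of a measurable $f$ on $\mathbb{T}$ is $\|f\|_\Phi=\inf\{k>0:\int_{\mathbb{T}}\Phi(|f|/k)\,dx\le1\}$. Matuszewska-Orlicz indices: with $M^\infty(t,\Phi)=\limsup_{u\to\infty}\Phi(tu)/\Phi(u)$, $$\alpha_\Phi^\infty=\lim_{t\to0+}\frac{\log M^\infty(t,\Phi)}{\log t},\qquad \beta_\Phi^\infty=\lim_{t\to\infty}\frac{\log M^\infty(t,\Phi)}{\log t}.$$ A set $S\subset\mathbb{Z}$ is a $\Lambda(\Phi)$-set if there are a nice Young function $\Phi_1$ with $\beta_{\Phi_1}^\infty<\alpha_\Phi^\infty$ and a constant $C'>0$ such that $\|\sum_{n\in S}a_ne^{2\pi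 inx}\|_\Phi\le C'\|\sum_{n\in S}a_ne^{2\pi inx}\|_{\Phi_1}$ for all finitely supported families $(a_n)_{n\in S}$ of complex numbers. *)

theory Defs
  imports "HOL-Analysis.Analysis"
begin

text \<open>
  Functions \<open>[0,\<infinity>) \<rightarrow> [0,\<infinity>)\<close> are represented by total functions \<open>real \<Rightarrow> real\<close>, of which only the
  values on \<open>{0..}\<close> are ever used. Only finite-valued Young functions are needed.
\<close>

definition young_function :: "(real \<Rightarrow> real) \<Rightarrow> bool" where
  "young_function \<Phi> \<longleftrightarrow>
     (\<forall>u\<ge>0. 0 \<le> \<Phi> u) \<and> convex_on {0..} \<Phi> \<and> \<Phi> 0 = 0 \<and> filterlim \<Phi> at_top at_top"

definition nice_young_function :: "(real \<Rightarrow> real) \<Rightarrow> bool" where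
  "nice_young_function \<Phi> \<longleftrightarrow>
     young_function \<Phi> \<and> continuous_on {0..} \<Phi> \<and>
     (\<forall>u\<ge>0. \<Phi> u = 0 \<longleftrightarrow> u = 0) \<and>
     ((\<lambda>u. \<Phi> u / u) \<longlongrightarrow> 0) (at_right 0) \<and>
     filterlim (\<lambda>u. \<Phi> u / u) at_top at_top"

definition young_inverse :: "(real \<Rightarrow> real) \<Rightarrow> real \<Rightarrow> real" where
  "young_inverse \<Phi> = the_inv_into {0..} \<Phi>"

text \<open>
  A function on \<open>\<real>/\<int>\<close> is represented by a 1-periodic function on the reals, integrated over a
  period. The value is \<open>\<infinity>\<close> if no \<open>k\<close> is admissible.
\<close>

definition orlicz_norm :: "(real \<Rightarrow> real) \<Rightarrow> (real \<Rightarrow> complex) \<Rightarrow> ennreal" where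
  "orlicz_norm \<Phi> f =
     Inf {ennreal k | k. k > 0 \<and> (\<integral>\<^sup>+x\<in>{0..<1}. ennreal (\<Phi> (cmod (f x) / k)) \<partial>lborel) \<le> 1}"

text \<open>
  The function \<open>M\<^sup>\<infinity>(t, \<Phi>)\<close> may be \<open>0\<close> for \<open>t < 1\<close> and \<open>\<infinity>\<close> for \<open>t > 1\<close> (e.g. when \<open>\<Phi>\<close> grows
  exponentially), so the logarithm and the indices take extended real values,
  with \<open>log 0 = -\<infinity>\<close> and \<open>log \<infinity> = \<infinity>\<close>.
\<close>

definition ereal_log :: "ereal \<Rightarrow> ereal" where
  "ereal_log x = (if x \<le> 0 then -\<infinity> else if x = \<infinity> then \<infinity> else ereal (ln (real_of_ereal x)))"

definition dilation_at_infinity :: "(real \<Rightarrow> real) \<Rightarrow> real \<Rightarrow> ereal" where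
  "dilation_at_infinity \<Phi> t = Limsup at_top (\<lambda>u. ereal (\<Phi> (t * u) / \<Phi> u))"

definition matuszewska_orlicz_alpha :: "(real \<Rightarrow> real) \<Rightarrow> ereal" where
  "matuszewska_orlicz_alpha \<Phi> =
     Lim (at_right 0) (\<lambda>t. ereal_log (dilation_at_infinity \<Phi> t) / ereal (ln t))"

definition matuszewska_orlicz_beta :: "(real \<Rightarrow> real) \<Rightarrow> ereal" where
  "matuszewska_orlicz_beta \<Phi> =
     Lim at_top (\<lambda>t. ereal_log (dilation_at_infinity \<Phi> t) / ereal (ln t))"

text \<open>The trigonometric polynomial of a family whose support in \<open>S\<close> is finite.\<close>

definition trig_poly :: "int set \<Rightarrow> (int \<Rightarrow> complex) \<Rightarrow> real \<Rightarrow> complex" where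
  "trig_poly S a x = (\<Sum>n | n \<in> S \<and> a n \<noteq> 0. a n * exp (2 * of_real pi * \<i> * of_int n * of_real x))"

definition Lambda_set :: "(real \<Rightarrow> real) \<Rightarrow> int set \<Rightarrow> bool" where
  "Lambda_set \<Phi> S \<longleftrightarrow>
     (\<exists>\<Phi>\<^sub>1 C'. nice_young_function \<Phi>\<^sub>1 \<and>
        matuszewska_orlicz_beta \<Phi>\<^sub>1 < matuszewska_orlicz_alpha \<Phi> \<and> C' > 0 \<and>
        (\<forall>a. finite {n \<in> S. a n \<noteq> 0} \<longrightarrow>
           orlicz_norm \<Phi> (trig_poly S a) \<le> ennreal C' * orlicz_norm \<Phi>\<^sub>1 (trig_poly S a)))"

end

theory Submission
  imports Defs
begin

text \<open>
  Let \<open>\<Psi>\<close> be the second Young function in the definition of a \<open>\<Lambda>(\<Phi>)\<close>-set. The gap between the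
  indices gives \<open>\<Psi>(u/\<epsilon>) \<le> \<Phi>(u)/3\<close> for large \<open>u\<close>, whatever \<open>\<epsilon> > 0\<close>, hence pointwise
  \<open>\<Psi>(g/(K a + \<epsilon> k)) \<le> (g/a)\<^sup>2/3 + \<Phi>(g/k)/3 + 1/3\<close>. Integrating,
  \<open>\<parallel>f\<parallel>\<^sub>\<Psi> \<le> K \<parallel>f\<parallel>\<^sub>2 + \<epsilon> \<parallel>f\<parallel>\<^sub>\<Phi>\<close>. For \<open>f\<close> with spectrum in \<open>S\<close> and \<open>\<epsilon> = 1/(2 C')\<close> the last term is
  absorbed by the left-hand side of \<open>\<parallel>f\<parallel>\<^sub>\<Phi> \<le> C' \<parallel>f\<parallel>\<^sub>\<Psi>\<close>, which leaves \<open>\<parallel>f\<parallel>\<^sub>\<Phi> = O(\<parallel>f\<parallel>\<^sub>2)\<close>. Apply this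
  to \<open>f = \<Sum>\<^sub>n\<^sub>\<in>\<^sub>A e\<^sup>2\<^sup>\<pi>\<^sup>i\<^sup>n\<^sup>x\<close> with \<open>A = S \<inter> [-N,N]\<close>: its \<open>L\<^sup>2\<close> norm is \<open>|A|\<^sup>1\<^sup>/\<^sup>2\<close>, while \<open>|f| \<ge> |A|/2\<close> near
  \<open>0\<close> forces \<open>\<parallel>f\<parallel>\<^sub>\<Phi>\<close> to be at least of order \<open>|A|/\<Phi>\<^sup>-\<^sup>1(N)\<close>.
\<close>

section \<open>Monotonicity, scaling and inversion of Young functions\<close>

lemma young_function_scale_le:
  assumes "young_function \<Phi>" "0 \<le> c" "c \<le> 1" "0 \<le> u"
  shows "\<Phi> (c * u) \<le> c * \<Phi> u"
proof -
  have "convex_on {0..} \<Phi>" "\<Phi> 0 = 0"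
    using assms(1) by (auto simp: young_function_def)
  then have "\<Phi> ((1 - c) *\<^sub>R 0 + c *\<^sub>R u) \<le> (1 - c) * \<Phi> 0 + c * \<Phi> u"
    using assms by (intro convex_onD) auto
  then show ?thesis
    using \<open>\<Phi> 0 = 0\<close> by simp
qed

lemma young_function_mono:
  assumes "young_function \<Phi>" "0 \<le> u" "u \<le> v"
  shows "\<Phi> u \<le> \<Phi> v"
proof (cases "v = 0")
  case False
  then have "v > 0" using assms by simp
  then have "\<Phi> (u / v * v) \<le> u / v * \<Phi> v"
    using assms \<open>v > 0\<close> by (intro young_function_scale_le[OF assms(1)]) auto
  also have "\<dots> \<le> 1 * \<Phi> v"
    using assms \<open>v > 0\<close> by (intro mult_right_mono) (auto simp: young_function_def)
  finally show ?thesis using \<open>v > 0\<close> by simp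
qed (use assms in auto)

lemma nice_young_function_pos:
  assumes "nice_young_function \<Phi>" "0 < u"
  shows "0 < \<Phi> u"
proof -
  have "0 \<le> \<Phi> u" "\<Phi> u \<noteq> 0"
    using assms by (auto simp: nice_young_function_def young_function_def)
  then show ?thesis by simp
qed

lemma nice_young_function_strict_mono:
  assumes "nice_young_function \<Phi>" "0 \<le> u" "u < v"
  shows "\<Phi> u < \<Phi> v"
proof -
  have "\<Phi> (u / v * v) \<le> u / v * \<Phi> v"
    using assms by (intro young_function_scale_le) (auto simp: nice_young_function_def)
  also have "\<dots> < 1 * \<Phi> v"
    using assms nice_young_function_pos[OF assms(1), of v]
    by (intro mult_strict_right_mono) auto
  finally show ?thesis using assms by simp
qed

text \<open>This makes \<open>the_inv_into\<close> in \<open>young_inverse\<close> a genuine inverse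
  on the half-line. Injectivity is strict monotonicity; surjectivity is the intermediate value
  theorem combined with growth at infinity.\<close>

lemma bij_betw_nice_young_function:
  assumes "nice_young_function \<Phi>"
  shows "bij_betw \<Phi> {0..} {0..}"
proof -
  have Y: "young_function \<Phi>" and cont: "continuous_on {0..} \<Phi>"
    using assms by (auto simp: nice_young_function_def)
  have "inj_on \<Phi> {0..}"
  proof (rule inj_onI)
    fix u v assume "u \<in> {0..}" "v \<in> {0..}" "\<Phi> u = \<Phi> v"
    then show "u = v"
      using nice_young_function_strict_mono[OF assms, of u v]
        nice_young_function_strict_mono[OF assms, of v u]
      by (cases u v rule: linorder_cases) auto
  qed
  moreover have "y \<in> \<Phi> ` {0..}" if "0 \<le> y" for y
  proof -
    have "eventually (\<lambda>u. y \<le> \<Phi> u) at_top"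
      using Y by (simp only: young_function_def filterlim_at_top)
    then obtain u0 where "\<And>u. u0 \<le> u \<Longrightarrow> y \<le> \<Phi> u"
      unfolding eventually_at_top_linorder by blast
    then have "y \<le> \<Phi> (max 0 u0)" by simp
    then obtain u where "y \<le> \<Phi> u" "0 \<le> u"
      using that[of "max 0 u0"] by simp
    moreover have "\<Phi> 0 \<le> y" using Y that by (simp add: young_function_def)
    moreover have "continuous_on {0..u} \<Phi>"
      using cont by (rule continuous_on_subset) auto
    ultimately have "\<exists>x\<ge>0. x \<le> u \<and> \<Phi> x = y"
      using IVT'[of \<Phi> 0 y u] by blast
    then show ?thesis by auto
  qed
  moreover have "\<Phi> ` {0..} \<subseteq> {0..}"
    using Y by (simp add: young_function_def image_subset_iff)
  ultimately show ?thesis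
    unfolding bij_betw_def by (metis atLeast_iff subsetI subset_antisym)
qed

text \<open>The form in which the inverse function enters the main estimate: a bound on the values
  of \<Phi> becomes a bound on its argument.\<close>

lemma le_young_inverse:
  assumes "nice_young_function \<Phi>" "0 \<le> u" "\<Phi> u \<le> y"
  shows "u \<le> young_inverse \<Phi> y"
proof (rule ccontr)
  have bij: "bij_betw \<Phi> {0..} {0..}"
    using assms(1) by (rule bij_betw_nice_young_function)
  have "0 \<le> \<Phi> u"
    using assms by (auto simp: nice_young_function_def young_function_def)
  then have "y \<in> \<Phi> ` {0..}"
    using bij assms by (simp add: bij_betw_def)
  then have inv: "young_inverse \<Phi> y \<in> {0..}" "\<Phi> (young_inverse \<Phi> y) = y"
    using bij unfolding young_inverse_def bij_betw_def
    by (auto intro: the_inv_into_into[where B="{0..}", simplified] f_the_inv_into_f)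
  assume "\<not> u \<le> young_inverse \<Phi> y"
  then have "y < \<Phi> u"
    using nice_young_function_strict_mono[OF assms(1), of "young_inverse \<Phi> y" u] inv by simp
  then show False using assms by simp
qed

subsection \<open>Matuszewska-Orlicz indices\<close>

text \<open>Locating \<open>t\<close> between consecutive powers of \<open>s\<close> lets an
  estimate for the single dilation \<open>s\<close>, once iterated, cover every dilation
  \<open>t \<ge> 1\<close>.\<close>

lemma ex_power_interval:
  fixes s t :: real
  assumes "1 < s" "1 \<le> t"
  obtains n :: nat where "s ^ n \<le> t" "t < s ^ Suc n"
proof -
  define n where "n = nat \<lfloor>log s t\<rfloor>"
  have "0 \<le> log s t" using assms by simp
  then have "real n \<le> log s t" "log s t < real (Suc n)"
    unfolding n_def by linarith+
  then have "s powr real n \<le> s powr log s t" "s powr log s t < s powr real (Suc n)"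
    using assms by (auto intro!: powr_mono powr_less_mono simp del: powr_log_cancel)
  then have "s ^ n \<le> t" "t < s ^ Suc n"
    using assms by (simp_all add: powr_realpow del: of_nat_Suc power_Suc)
  then show ?thesis by (rule that)
qed

lemma filterlim_powr_at_top:
  fixes r :: real
  assumes "0 < r"
  shows "filterlim (\<lambda>t. t powr r) at_top at_top"
proof -
  have "filterlim (\<lambda>t. exp (r * ln t)) at_top at_top"
    using assms by (intro filterlim_compose[OF exp_at_top]
        filterlim_tendsto_pos_mult_at_top[OF tendsto_const] ln_at_top)
  moreover have "eventually (\<lambda>t. exp (r * ln t) = t powr r) at_top"
    using eventually_gt_at_top[of 0] by eventually_elim (simp add: powr_def)
  ultimately show ?thesis by (rule filterlim_cong[THEN iffD1, OF refl refl, rotated])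
qed

lemma powr_power_commute:
  fixes s q :: real
  assumes "0 < s"
  shows "(s powr q) ^ n = (s ^ n) powr q"
  using assms by (simp add: powr_realpow[symmetric] powr_powr mult.commute)

text \<open>The one-step bound is iterated \<open>n\<close> times, with
  \<open>s ^ n \<le> t < s ^ Suc n\<close>. Rounding \<open>t\<close> down to \<open>s ^ n\<close>
  loses at most one step, which the factor \<open>s powr (-q)\<close> pays for.\<close>

lemma dilation_iterate_ge:
  assumes "nice_young_function \<Phi>" "1 < s" "0 \<le> q" "0 \<le> v0"
    and step: "\<And>v. v0 \<le> v \<Longrightarrow> s powr q * \<Phi> v \<le> \<Phi> (s * v)"
    and "1 \<le> t" "v0 \<le> v"
  shows "s powr (-q) * t powr q * \<Phi> v \<le> \<Phi> (t * v)"
proof -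
  have Y: "young_function \<Phi>" using assms(1) by (simp add: nice_young_function_def)
  obtain n where n: "s ^ n \<le> t" "t < s ^ Suc n"
    using ex_power_interval assms by blast
  have iter: "(s powr q) ^ k * \<Phi> v \<le> \<Phi> (s ^ k * v)" for k
  proof (induction k)
    case (Suc k)
    have "1 * v \<le> s ^ k * v"
      using assms by (intro mult_right_mono) auto
    have "(s powr q) ^ Suc k * \<Phi> v \<le> s powr q * \<Phi> (s ^ k * v)"
      using Suc by (simp add: mult.assoc mult_left_mono)
    also have "\<dots> \<le> \<Phi> (s * (s ^ k * v))"
      using \<open>1 * v \<le> s ^ k * v\<close> assms by (intro step) auto
    finally show ?case by (simp add: mult.assoc)
  qed simp
  have "t powr q \<le> (s ^ Suc n) powr q"
    using n assms by (intro powr_mono2) auto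
  also have "\<dots> = s powr q * (s powr q) ^ n"
    using assms by (simp add: powr_mult powr_power_commute)
  finally have "s powr (-q) * t powr q \<le> (s powr q) ^ n"
    using assms by (simp add: powr_minus field_simps)
  then have "s powr (-q) * t powr q * \<Phi> v \<le> (s powr q) ^ n * \<Phi> v"
    using Y assms by (intro mult_right_mono) (auto simp: young_function_def)
  also have "\<dots> \<le> \<Phi> (s ^ n * v)" by (rule iter)
  also have "\<dots> \<le> \<Phi> (t * v)"
    using n assms by (intro young_function_mono[OF Y] mult_right_mono) auto
  finally show ?thesis .
qed

text \<open>The upper counterpart: \<open>t\<close> is rounded up to \<open>s ^ Suc n\<close>, and
  the extra step costs the factor \<open>s powr p\<close>.\<close>

lemma dilation_iterate_le:
  assumes "nice_young_function \<Phi>" "1 < s" "0 \<le> p" "0 \<le> v0"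
    and step: "\<And>v. v0 \<le> v \<Longrightarrow> \<Phi> (s * v) \<le> s powr p * \<Phi> v"
    and "1 \<le> t" "v0 \<le> v"
  shows "\<Phi> (t * v) \<le> s powr p * t powr p * \<Phi> v"
proof -
  have Y: "young_function \<Phi>" using assms(1) by (simp add: nice_young_function_def)
  obtain n where n: "s ^ n \<le> t" "t < s ^ Suc n"
    using ex_power_interval assms by blast
  have iter: "\<Phi> (s ^ k * v) \<le> (s powr p) ^ k * \<Phi> v" for k
  proof (induction k)
    case (Suc k)
    have "1 * v \<le> s ^ k * v"
      using assms by (intro mult_right_mono) auto
    then have "\<Phi> (s * (s ^ k * v)) \<le> s powr p * \<Phi> (s ^ k * v)"
      using assms by (intro step) auto
    also have "\<dots> \<le> (s powr p) ^ Suc k * \<Phi> v"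
      using Suc by (simp add: mult.assoc mult_left_mono)
    finally show ?case by (simp add: mult.assoc)
  qed simp
  have "\<Phi> (t * v) \<le> \<Phi> (s ^ Suc n * v)"
    using n assms by (intro young_function_mono[OF Y] mult_right_mono) auto
  also have "\<dots> \<le> (s powr p) ^ Suc n * \<Phi> v" by (rule iter)
  also have "(s powr p) ^ n = (s ^ n) powr p"
    using assms by (simp add: powr_power_commute)
  then have "(s powr p) ^ Suc n * \<Phi> v = s powr p * (s ^ n) powr p * \<Phi> v" by simp
  also have "\<dots> \<le> s powr p * t powr p * \<Phi> v"
    using Y n assms
    by (intro mult_right_mono mult_left_mono powr_mono2) (auto simp: young_function_def)
  finally show ?thesis .
qed

section \<open>The dilation function at infinity and power growth\<close>

lemma dilation_at_infinity_lessD: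
  assumes "nice_young_function \<Phi>" "dilation_at_infinity \<Phi> t < ereal c"
  shows "eventually (\<lambda>u. \<Phi> (t * u) \<le> c * \<Phi> u) at_top"
proof -
  have "eventually (\<lambda>u. ereal (\<Phi> (t * u) / \<Phi> u) < ereal c) at_top"
    using assms(2) unfolding dilation_at_infinity_def by (rule Limsup_lessD)
  then show ?thesis
    using eventually_gt_at_top[of 0]
  proof eventually_elim
    case (elim u)
    then show ?case
      using nice_young_function_pos[OF assms(1), of u] by (simp add: field_simps)
  qed
qed

lemma dilation_at_infinity_leI:
  assumes "nice_young_function \<Phi>" "eventually (\<lambda>u. \<Phi> (t * u) \<le> c * \<Phi> u) at_top"
  shows "dilation_at_infinity \<Phi> t \<le> ereal c"
  unfolding dilation_at_infinity_def
proof (rule Limsup_bounded)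
  show "eventually (\<lambda>u. ereal (\<Phi> (t * u) / \<Phi> u) \<le> ereal c) at_top"
    using assms(2) eventually_gt_at_top[of 0]
  proof eventually_elim
    case (elim u)
    then show ?case
      using nice_young_function_pos[OF assms(1), of u] by (simp add: field_simps)
  qed
qed

lemma dilation_at_infinity_geI:
  assumes "nice_young_function \<Phi>" "eventually (\<lambda>u. c * \<Phi> u \<le> \<Phi> (t * u)) at_top"
  shows "ereal c \<le> dilation_at_infinity \<Phi> t"
proof -
  have "eventually (\<lambda>u. ereal c \<le> ereal (\<Phi> (t * u) / \<Phi> u)) at_top"
    using assms(2) eventually_gt_at_top[of 0]
  proof eventually_elim
    case (elim u)
    then show ?case
      using nice_young_function_pos[OF assms(1), of u] by (simp add: field_simps)
  qed
  then have "ereal c \<le> Liminf at_top (\<lambda>u. ereal (\<Phi> (t * u) / \<Phi> u))"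
    by (rule Liminf_bounded)
  also have "\<dots> \<le> dilation_at_infinity \<Phi> t"
    unfolding dilation_at_infinity_def by (rule Liminf_le_Limsup) simp
  finally show ?thesis .
qed

lemma dilation_at_infinity_nonneg:
  assumes "nice_young_function \<Phi>" "0 \<le> t"
  shows "0 \<le> dilation_at_infinity \<Phi> t"
proof -
  have "eventually (\<lambda>u. 0 * \<Phi> u \<le> \<Phi> (t * u)) at_top"
    using eventually_ge_at_top[of 0]
    by eventually_elim (use assms in \<open>auto simp: nice_young_function_def young_function_def\<close>)
  then show ?thesis
    using dilation_at_infinity_geI[OF assms(1), of 0 t] by (simp add: zero_ereal_def)
qed

text \<open>Dividing by the negative number \<open>ln t\<close> reverses the inequality. The
  conventions for \<open>ereal_log\<close> cover the extreme values too: for \<open>x = 0\<close>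
  the quotient is \<infinity> and both sides hold, for \<open>x = \<infinity>\<close> it is
  -\<infinity> and both fail.\<close>

lemma less_ereal_log_div_iff:
  assumes "0 \<le> x" "0 < t" "t < 1"
  shows "ereal q < ereal_log x / ereal (ln t) \<longleftrightarrow> x < ereal (t powr q)"
proof (cases x)
  case (real r)
  then show ?thesis
  proof (cases "r = 0")
    case False
    then have "r > 0" using real assms by simp
    have "q < ln r / ln t \<longleftrightarrow> ln r < q * ln t"
      using assms by (simp add: neg_less_divide_eq)
    also have "\<dots> \<longleftrightarrow> r < t powr q"
      using assms \<open>r > 0\<close> by (subst exp_less_cancel_iff[of "ln r", symmetric]) (simp add: powr_def)
    finally show ?thesis
      using real \<open>r > 0\<close> assms by (simp add: ereal_log_def)
  qed (use real assms in \<open>simp add: ereal_log_def zero_ereal_def[symmetric] ereal_divide\<close>)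
qed (use assms in \<open>auto simp: ereal_log_def\<close>)

lemma ereal_log_div_less_iff:
  assumes "0 \<le> x" "1 < t"
  shows "ereal_log x / ereal (ln t) < ereal q \<longleftrightarrow> x < ereal (t powr q)"
proof (cases x)
  case (real r)
  then show ?thesis
  proof (cases "r = 0")
    case False
    then have "r > 0" using real assms by simp
    have "ln r / ln t < q \<longleftrightarrow> ln r < q * ln t"
      using assms by (simp add: pos_divide_less_eq)
    also have "\<dots> \<longleftrightarrow> r < t powr q"
      using assms \<open>r > 0\<close> by (subst exp_less_cancel_iff[of "ln r", symmetric]) (simp add: powr_def)
    finally show ?thesis
      using real \<open>r > 0\<close> assms by (simp add: ereal_log_def)
  qed (use real assms in \<open>simp add: ereal_log_def zero_ereal_def[symmetric] ereal_divide\<close>)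
qed (use assms in \<open>auto simp: ereal_log_def\<close>)

text \<open>A strict inequality at one dilation \<open>t0 < 1\<close> already gives power growth for
  all large dilations: read backwards, it is a one-step lower bound for \<open>s = 1 / t0\<close>,
  which can be iterated.\<close>

lemma dilation_at_infinity_lower_growth:
  assumes "nice_young_function \<Phi>" "0 < t0" "t0 < 1" "0 \<le> q"
    and "dilation_at_infinity \<Phi> t0 < ereal (t0 powr q)"
  shows "\<exists>c>0. \<exists>v0>0. \<forall>t\<ge>1. \<forall>v\<ge>v0. c * t powr q * \<Phi> v \<le> \<Phi> (t * v)"
proof -
  obtain u0 where u0: "\<And>u. u0 \<le> u \<Longrightarrow> \<Phi> (t0 * u) \<le> t0 powr q * \<Phi> u"
    using dilation_at_infinity_lessD[OF assms(1,5)] by (auto simp: eventually_at_top_linorder)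
  define v0 where "v0 = max 1 u0"
  define s where "s = 1 / t0"
  have s: "1 < s" "0 < s" using assms by (auto simp: s_def)
  have "s powr q * \<Phi> v \<le> \<Phi> (s * v)" if "v0 \<le> v" for v
  proof -
    have "1 * v \<le> s * v"
      using s that by (intro mult_right_mono) (auto simp: v0_def)
    then have "u0 \<le> s * v" using that unfolding v0_def by linarith
    then have "\<Phi> (t0 * (s * v)) \<le> t0 powr q * \<Phi> (s * v)" by (rule u0)
    then show ?thesis
      using assms by (simp add: s_def powr_divide field_simps)
  qed
  then have "\<forall>t\<ge>1. \<forall>v\<ge>v0. s powr (-q) * t powr q * \<Phi> v \<le> \<Phi> (t * v)"
    using assms s
    by (intro allI impI dilation_iterate_ge[where ?v0.0 = v0]) (auto simp: v0_def)
  then show ?thesis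
    using s by (intro exI[of _ "s powr (-q)"] exI[of _ v0] conjI) (auto simp: v0_def)
qed

lemma dilation_at_infinity_upper_growth:
  assumes "nice_young_function \<Phi>" "1 < s" "0 \<le> p"
    and "dilation_at_infinity \<Phi> s < ereal (s powr p)"
  shows "\<exists>c>0. \<exists>v0>0. \<forall>t\<ge>1. \<forall>v\<ge>v0. \<Phi> (t * v) \<le> c * t powr p * \<Phi> v"
proof -
  obtain u0 where u0: "\<And>u. u0 \<le> u \<Longrightarrow> \<Phi> (s * u) \<le> s powr p * \<Phi> u"
    using dilation_at_infinity_lessD[OF assms(1,4)] by (auto simp: eventually_at_top_linorder)
  define v0 where "v0 = max 1 u0"
  have "\<forall>t\<ge>1. \<forall>v\<ge>v0. \<Phi> (t * v) \<le> s powr p * t powr p * \<Phi> v"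
    using assms u0
    by (intro allI impI dilation_iterate_le[where ?v0.0 = v0]) (auto simp: v0_def)
  then show ?thesis
    using assms by (intro exI[of _ "s powr p"] exI[of _ v0] conjI) (auto simp: v0_def)
qed

text \<open>
  \<^const>\<open>Lim\<close> is a definite description, so the indices carry no information until the limits are
  known to exist. As in Fekete's lemma, submultiplicativity makes the limit at \<open>0\<close> a supremum
  and the limit at \<open>\<infinity>\<close> an infimum.
\<close>

lemma tendsto_matuszewska_orlicz_alpha:
  assumes N: "nice_young_function \<Phi>"
  shows "((\<lambda>t. ereal_log (dilation_at_infinity \<Phi> t) / ereal (ln t)) \<longlongrightarrow>
           matuszewska_orlicz_alpha \<Phi>) (at_right 0)"
proof -
  define F where "F t = ereal_log (dilation_at_infinity \<Phi> t) / ereal (ln t)" for t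
  define L where "L = (SUP t\<in>{0<..<1}. F t)"
  have Y: "young_function \<Phi>" using N by (simp add: nice_young_function_def)
  have ev01: "eventually (\<lambda>t::real. t \<in> {0<..<1}) (at_right 0)"
    by (rule eventually_at_right_real) simp
  have F_iff: "ereal q < F t \<longleftrightarrow> dilation_at_infinity \<Phi> t < ereal (t powr q)"
    if "t \<in> {0<..<1}" for q t
    unfolding F_def using that dilation_at_infinity_nonneg[OF N]
    by (intro less_ereal_log_div_iff) auto
  have "(F \<longlongrightarrow> L) (at_right 0)"
  proof (rule order_tendstoI)
    fix a assume "a < L"
    then obtain t0 where t0: "t0 \<in> {0<..<1}" "a < F t0"
      unfolding L_def less_SUP_iff by blast
    obtain q where q: "a < ereal q" "ereal q < F t0"
      using ereal_dense2[OF t0(2)] by blast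
    \<comment> \<open>Two exponents are used: iteration gives the exponent \<open>q'\<close> up to a
      constant \<open>1 / c\<close>, and the gap \<open>q' - q\<close> absorbs that constant as
      \<open>t\<close> tends to 0.\<close>
    obtain q' where q': "ereal q < ereal q'" "ereal q' < F t0"
      using ereal_dense2[OF q(2)] by blast
    have "eventually (\<lambda>t. ereal q < F t) (at_right 0)"
    proof (cases "q < 0")
      case True
      \<comment> \<open>Iteration works with nonnegative exponents, so negative \<open>q\<close> is
        settled by monotonicity of \<Phi> alone.\<close>
      have "dilation_at_infinity \<Phi> t \<le> ereal 1" if "t \<in> {0<..<1}" for t
      proof (rule dilation_at_infinity_leI[OF N])
        show "eventually (\<lambda>u. \<Phi> (t * u) \<le> 1 * \<Phi> u) at_top"
          using eventually_ge_at_top[of 0]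
          by eventually_elim
            (use that in \<open>auto intro!: young_function_mono[OF Y] mult_left_le_one_le\<close>)
      qed
      moreover have "1 < t powr q" if "t \<in> {0<..<1}" for t
        using that True by (simp add: powr_def mult_neg_neg)
      ultimately have "ereal q < F t" if "t \<in> {0<..<1}" for t
        unfolding F_iff[OF that] using that by (meson le_less_trans less_ereal.simps(1))
      then show ?thesis
        using ev01 by (rule eventually_mono[rotated])
    next
      case False
      with q' have "0 \<le> q'" by simp
      obtain c v0 where c: "0 < c" "0 < v0"
        and grow: "\<And>t v. 1 \<le> t \<Longrightarrow> v0 \<le> v \<Longrightarrow> c * t powr q' * \<Phi> v \<le> \<Phi> (t * v)"
        using dilation_at_infinity_lower_growth[OF N _ _ \<open>0 \<le> q'\<close>, of t0] q'(2) t0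
        unfolding F_iff[OF t0(1)] by auto
      have M: "dilation_at_infinity \<Phi> t \<le> ereal (t powr q' / c)" if "t \<in> {0<..<1}" for t
      proof (rule dilation_at_infinity_leI[OF N])
        show "eventually (\<lambda>u. \<Phi> (t * u) \<le> t powr q' / c * \<Phi> u) at_top"
          using eventually_ge_at_top[of "v0 / t"]
        proof eventually_elim
          case (elim u)
          \<comment> \<open>The growth bound concerns dilations of size at least 1, so it is applied
            to \<open>1 / t\<close> at the point \<open>t * u\<close>.\<close>
          then have "c * (1 / t) powr q' * \<Phi> (t * u) \<le> \<Phi> (1 / t * (t * u))"
            using that by (intro grow) (auto simp: field_simps)
          then show ?case
            using that c by (simp add: powr_divide field_simps)
        qed
      qed
      have "((\<lambda>t::real. t powr (q' - q)) \<longlongrightarrow> 0) (at_right 0)"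
        using q' by (intro tendsto_zero_powrI[where b="q' - q"] tendsto_ident_at tendsto_const)
          (auto simp: eventually_at_right_field intro: exI[of _ 1])
      then have "eventually (\<lambda>t. t powr (q' - q) < c) (at_right 0)"
        using c(1) by (rule order_tendstoD)
      then show ?thesis
        using ev01
      proof eventually_elim
        case (elim t)
        have "t powr q' / c < t powr q"
          using elim c by (simp add: powr_diff field_simps)
        then show ?case
          unfolding F_iff[OF elim(2)] using M[OF elim(2)]
          by (meson le_less_trans less_ereal.simps(1))
      qed
    qed
    then show "eventually (\<lambda>t. a < F t) (at_right 0)"
      by (rule eventually_mono) (use q in auto)
  next
    fix a assume "L < a"
    show "eventually (\<lambda>t. F t < a) (at_right 0)"
      using ev01
    proof eventually_elim
      case (elim t)
      then have "F t \<le> L" unfolding L_def by (rule SUP_upper)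
      then show ?case using \<open>L < a\<close> by simp
    qed
  qed
  moreover from this have "Lim (at_right 0) F = L"
    by (intro tendsto_Lim) (auto simp: trivial_limit_at_right_real)
  ultimately show ?thesis
    by (simp add: matuszewska_orlicz_alpha_def F_def[abs_def])
qed

lemma tendsto_matuszewska_orlicz_beta:
  assumes N: "nice_young_function \<Phi>"
  shows "((\<lambda>t. ereal_log (dilation_at_infinity \<Phi> t) / ereal (ln t)) \<longlongrightarrow>
           matuszewska_orlicz_beta \<Phi>) at_top"
proof -
  define F where "F t = ereal_log (dilation_at_infinity \<Phi> t) / ereal (ln t)" for t
  define L where "L = (INF t\<in>{1<..}. F t)"
  have Y: "young_function \<Phi>" using N by (simp add: nice_young_function_def)
  have F_iff: "F t < ereal q \<longleftrightarrow> dilation_at_infinity \<Phi> t < ereal (t powr q)"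
    if "1 < t" for q t
    unfolding F_def using that dilation_at_infinity_nonneg[OF N]
    by (intro ereal_log_div_less_iff) auto
  have "(F \<longlongrightarrow> L) at_top"
  proof (rule order_tendstoI)
    fix a assume "L < a"
    then obtain s where s: "1 < s" "F s < a"
      unfolding L_def INF_less_iff by auto
    obtain p' where p': "F s < ereal p'" "ereal p' < a"
      using ereal_dense2[OF s(2)] by blast
    obtain p where p: "F s < ereal p" "ereal p < ereal p'"
      using ereal_dense2[OF p'(1)] by blast
    \<comment> \<open>Iteration needs a nonnegative exponent. A negative \<open>p\<close> would put
      the dilation function at \<open>s\<close> below 1, against the monotonicity of \<Phi>.\<close>
    have "0 \<le> p"
    proof (rule ccontr)
      assume "\<not> 0 \<le> p"
      then have "s powr p < 1" using s by (simp add: powr_less_one)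
      moreover have "ereal 1 \<le> dilation_at_infinity \<Phi> s"
      proof (rule dilation_at_infinity_geI[OF N])
        show "eventually (\<lambda>u. 1 * \<Phi> u \<le> \<Phi> (s * u)) at_top"
          using eventually_ge_at_top[of 0]
        proof eventually_elim
          case (elim u)
          then have "1 * u \<le> s * u" using s by (intro mult_right_mono) auto
          then show ?case using elim young_function_mono[OF Y, of u "s * u"] by simp
        qed
      qed
      moreover have "dilation_at_infinity \<Phi> s < ereal (s powr p)"
        using p(1) unfolding F_iff[OF s(1)] .
      ultimately have "ereal 1 < ereal (s powr p)"
        by (meson le_less_trans)
      then show False using \<open>s powr p < 1\<close> by simp
    qed
    obtain c v0 where c: "0 < c" "0 < v0"
      and grow: "\<And>t v. 1 \<le> t \<Longrightarrow> v0 \<le> v \<Longrightarrow> \<Phi> (t * v) \<le> c * t powr p * \<Phi> v"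
      using dilation_at_infinity_upper_growth[OF N s(1) \<open>0 \<le> p\<close>] p(1)
      unfolding F_iff[OF s(1)] by auto
    have M: "dilation_at_infinity \<Phi> t \<le> ereal (c * t powr p)" if "1 < t" for t
    proof (rule dilation_at_infinity_leI[OF N])
      show "eventually (\<lambda>u. \<Phi> (t * u) \<le> c * t powr p * \<Phi> u) at_top"
        using eventually_ge_at_top[of v0] by eventually_elim (use that in \<open>auto intro!: grow\<close>)
    qed
    \<comment> \<open>The gap \<open>p' - p\<close> absorbs the constant \<open>c\<close> for large
      \<open>t\<close>.\<close>
    have "filterlim (\<lambda>t::real. t powr (p' - p)) at_top at_top"
      using p(2) by (intro filterlim_powr_at_top) auto
    then have "eventually (\<lambda>t. c < t powr (p' - p)) at_top"
      by (simp add: filterlim_at_top_dense)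
    then show "eventually (\<lambda>t. F t < a) at_top"
      using eventually_gt_at_top[of 1]
    proof eventually_elim
      case (elim t)
      have "c * t powr p < t powr p'"
        using elim by (simp add: powr_diff field_simps)
      then have "F t < ereal p'"
        unfolding F_iff[OF elim(2)] using M[OF elim(2)]
        by (meson le_less_trans less_ereal.simps(1))
      then show ?case using p' by simp
    qed
  next
    fix a assume "a < L"
    show "eventually (\<lambda>t. a < F t) at_top"
      using eventually_gt_at_top[of 1]
    proof eventually_elim
      case (elim t)
      then have "L \<le> F t" unfolding L_def by (intro INF_lower) auto
      then show ?case using \<open>a < L\<close> by simp
    qed
  qed
  moreover from this have "Lim at_top F = L"
    by (intro tendsto_Lim) auto
  ultimately show ?thesis
    by (simp add: matuszewska_orlicz_beta_def F_def[abs_def])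
qed

text \<open>Convergence to the index supplies one \<open>t\<close> in (0,1) with the strict
  inequality, and a single dilation suffices for power growth.\<close>

lemma matuszewska_orlicz_alpha_lower_growth:
  assumes N: "nice_young_function \<Phi>" and q: "0 \<le> q" "ereal q < matuszewska_orlicz_alpha \<Phi>"
  shows "\<exists>c>0. \<exists>v0>0. \<forall>t\<ge>1. \<forall>v\<ge>v0. c * t powr q * \<Phi> v \<le> \<Phi> (t * v)"
proof -
  have "eventually (\<lambda>t. ereal q < ereal_log (dilation_at_infinity \<Phi> t) / ereal (ln t) \<and> t \<in> {0<..<1})
          (at_right 0)"
    using order_tendstoD(1)[OF tendsto_matuszewska_orlicz_alpha[OF N] q(2)]
    by (intro eventually_conj eventually_at_right_real) auto
  then obtain t where t: "t \<in> {0<..<1}"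
    "ereal q < ereal_log (dilation_at_infinity \<Phi> t) / ereal (ln t)"
    using eventually_happens' trivial_limit_at_right_real by blast
  then have "dilation_at_infinity \<Phi> t < ereal (t powr q)"
    using less_ereal_log_div_iff dilation_at_infinity_nonneg[OF N] by auto
  then show ?thesis
    using t q by (intro dilation_at_infinity_lower_growth[OF N]) auto
qed

lemma matuszewska_orlicz_beta_upper_growth:
  assumes N: "nice_young_function \<Phi>" and p: "0 \<le> p" "matuszewska_orlicz_beta \<Phi> < ereal p"
  shows "\<exists>c>0. \<exists>v0>0. \<forall>t\<ge>1. \<forall>v\<ge>v0. \<Phi> (t * v) \<le> c * t powr p * \<Phi> v"
proof -
  have "eventually (\<lambda>t. ereal_log (dilation_at_infinity \<Phi> t) / ereal (ln t) < ereal p \<and> 1 < t) at_top"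
    using order_tendstoD(2)[OF tendsto_matuszewska_orlicz_beta[OF N] p(2)]
    by (intro eventually_conj eventually_gt_at_top) auto
  then obtain t where t: "1 < t"
    "ereal_log (dilation_at_infinity \<Phi> t) / ereal (ln t) < ereal p"
    using eventually_happens'[OF trivial_limit_at_top_linorder] by blast
  then have "dilation_at_infinity \<Phi> t < ereal (t powr p)"
    using ereal_log_div_less_iff dilation_at_infinity_nonneg[OF N] by auto
  then show ?thesis
    using t p by (intro dilation_at_infinity_upper_growth[OF N]) auto
qed

text \<open>Two exponents \<open>p < q\<close> fit between the indices. Then \<Psi> grows at most
  like the power \<open>p\<close> and \<Phi> at least like the power \<open>q\<close>, so any fixed
  dilation \<open>l\<close> and factor \<open>d\<close> are eventually outweighed.\<close>

lemma eventually_dilate_le_of_indices: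
  assumes N: "nice_young_function \<Phi>" and N1: "nice_young_function \<Psi>"
    and less: "matuszewska_orlicz_beta \<Psi> < matuszewska_orlicz_alpha \<Phi>"
    and pos: "0 < matuszewska_orlicz_alpha \<Phi>"
    and "0 < l" "0 < d"
  shows "eventually (\<lambda>u. \<Psi> (l * u) \<le> d * \<Phi> u) at_top"
proof -
  \<comment> \<open>The maximum with 0 keeps \<open>p\<close> nonnegative, as the growth lemmas
    require.\<close>
  have "max 0 (matuszewska_orlicz_beta \<Psi>) < matuszewska_orlicz_alpha \<Phi>"
    using less pos by simp
  then obtain p where p: "max 0 (matuszewska_orlicz_beta \<Psi>) < ereal p"
      "ereal p < matuszewska_orlicz_alpha \<Phi>"
    using ereal_dense2 by blast
  obtain q where q: "ereal p < ereal q" "ereal q < matuszewska_orlicz_alpha \<Phi>"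
    using ereal_dense2[OF p(2)] by blast
  have "0 \<le> p" "matuszewska_orlicz_beta \<Psi> < ereal p" "p < q" "0 \<le> q"
    using p q by (auto simp: zero_ereal_def[symmetric] dest: less_imp_le)
  obtain c v where c: "0 < c" "0 < v"
    and Q: "\<And>t. 1 \<le> t \<Longrightarrow> c * t powr q * \<Phi> v \<le> \<Phi> (t * v)"
    using matuszewska_orlicz_alpha_lower_growth[OF N \<open>0 \<le> q\<close> q(2)] by fastforce
  obtain e w where e: "0 < e" "0 < w"
    and P: "\<And>t. 1 \<le> t \<Longrightarrow> \<Psi> (t * w) \<le> e * t powr p * \<Psi> w"
    using matuszewska_orlicz_beta_upper_growth[OF N1 \<open>0 \<le> p\<close> \<open>matuszewska_orlicz_beta \<Psi> < ereal p\<close>]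
    by fastforce
  have pos': "0 < \<Phi> v" "0 < \<Psi> w"
    using c e nice_young_function_pos[OF N] nice_young_function_pos[OF N1] by auto
  \<comment> \<open>\<open>A\<close> and \<open>B\<close> collect the constants so that
    \<open>\<Psi> (l * u) \<le> A * u powr p\<close> and
    \<open>B * u powr q \<le> d * \<Phi> u\<close> for large \<open>u\<close>.\<close>
  define A where "A = e * (l / w) powr p * \<Psi> w"
  define B where "B = d * c * (1 / v) powr q * \<Phi> v"
  have "0 < B" using pos' c assms by (simp add: B_def)
  have "filterlim (\<lambda>t::real. t powr (q - p)) at_top at_top"
    using \<open>p < q\<close> by (intro filterlim_powr_at_top) auto
  then have "eventually (\<lambda>u. A / B \<le> u powr (q - p)) at_top"
    by (simp add: filterlim_at_top)
  then show ?thesis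
    using eventually_ge_at_top[of "max v (w / l)"]
  proof eventually_elim
    case (elim u)
    then have u: "0 < u" "1 \<le> u / v" "1 \<le> l * u / w"
      using c e assms by (auto simp: field_simps)
    have "\<Psi> (l * u) \<le> e * (l * u / w) powr p * \<Psi> w"
      using P[OF u(3)] e by simp
    also have "\<dots> = A * u powr p"
      using u e assms powr_mult[of "l / w" u p] by (simp add: A_def)
    also have "\<dots> \<le> B * u powr q"
      using elim(1) \<open>0 < B\<close> u by (simp add: powr_diff field_simps)
    also have "\<dots> = d * (c * (u / v) powr q * \<Phi> v)"
      using u c powr_mult[of "1 / v" u q] by (simp add: B_def)
    also have "\<dots> \<le> d * \<Phi> u"
      using Q[OF u(2)] c assms by (intro mult_left_mono) auto
    finally show ?case .
  qed
qed

subsection \<open>Comparison of Orlicz norms\<close>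

lemma young_function_small:
  assumes "young_function \<Phi>" "0 < d"
  obtains u where "0 < u" "\<Phi> u \<le> d"
proof -
  have nn: "0 \<le> \<Phi> 1" using assms(1) by (simp add: young_function_def)
  \<comment> \<open>A Young function may vanish at 1, hence the \<open>+ 1\<close> in the
    denominator.\<close>
  define c where "c = min 1 (d / (\<Phi> 1 + 1))"
  have c: "0 < c" "c \<le> 1" "c \<le> d / (\<Phi> 1 + 1)"
    using nn assms by (auto simp: c_def)
  then have "\<Phi> c \<le> c * \<Phi> 1"
    using young_function_scale_le[OF assms(1), of c 1] by simp
  also have "\<dots> \<le> c * (\<Phi> 1 + 1)" using c by simp
  also have "\<dots> \<le> d" using c nn by (simp add: field_simps)
  finally show ?thesis using c that by blast
qed

text \<open>Each regime of \<open>g\<close> is paid for by one summand: large \<open>g / k\<close>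
  by the \<Phi> term through the hypothesis, small \<open>g / (K * a)\<close> by the constant, and
  the remaining range, where the left side is at most \<open>D\<close>, by the square.
  \<open>K\<close> depends on none of \<open>g\<close>, \<open>a\<close>, \<open>k\<close>.\<close>

lemma young_function_interpolation:
  assumes \<Phi>: "young_function \<Phi>" and \<Psi>: "young_function \<Psi>" and "0 < \<epsilon>"
    and ev: "eventually (\<lambda>u. \<Psi> (1 / \<epsilon> * u) \<le> 1 / 3 * \<Phi> u) at_top"
  obtains K where "0 < K"
    and "\<And>g a k. 0 \<le> g \<Longrightarrow> 0 < a \<Longrightarrow> 0 < k \<Longrightarrow>
           \<Psi> (g / (K * a + \<epsilon> * k)) \<le> (g / a)\<^sup>2 / 3 + \<Phi> (g / k) / 3 + 1 / 3"
proof -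
  obtain B0 where B0: "\<And>u. B0 \<le> u \<Longrightarrow> \<Psi> (1 / \<epsilon> * u) \<le> 1 / 3 * \<Phi> u"
    using ev unfolding eventually_at_top_linorder by blast
  define B where "B = max 1 B0"
  have B: "0 < B" "\<And>u. B \<le> u \<Longrightarrow> \<Psi> (1 / \<epsilon> * u) \<le> 1 / 3 * \<Phi> u"
    using B0 by (auto simp: B_def)
  obtain \<eta> where \<eta>: "0 < \<eta>" "\<Psi> \<eta> \<le> 1 / 3"
    using young_function_small[OF \<Psi>, of "1 / 3"] by auto
  define D where "D = \<Psi> (B / \<epsilon>)"
  have "0 \<le> D"
    using \<Psi> B \<open>0 < \<epsilon>\<close> by (simp add: D_def young_function_def)
  \<comment> \<open>Chosen so that \<open>g / (K * a) > \<eta>\<close> forces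
    \<open>g / a \<ge> 3 * D + 1\<close>. This is at least 1, so squaring keeps the bound and a
    third of the square exceeds \<open>D\<close>.\<close>
  define K where "K = (3 * D + 1) / \<eta>"
  have "0 < K" using \<open>0 \<le> D\<close> \<eta> by (simp add: K_def)
  have "\<Psi> (g / (K * a + \<epsilon> * k)) \<le> (g / a)\<^sup>2 / 3 + \<Phi> (g / k) / 3 + 1 / 3"
    if g: "0 \<le> g" "0 < a" "0 < k" for g a k
  proof -
    have "0 \<le> \<Phi> (g / k)" using \<Phi> g by (simp add: young_function_def)
    have "g / (K * a + \<epsilon> * k) \<le> g / (\<epsilon> * k)"
      using g \<open>0 < K\<close> \<open>0 < \<epsilon>\<close> by (intro divide_left_mono) (auto intro!: add_pos_pos mult_pos_pos)
    then have 1: "\<Psi> (g / (K * a + \<epsilon> * k)) \<le> \<Psi> (1 / \<epsilon> * (g / k))"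
      using g \<open>0 < K\<close> \<open>0 < \<epsilon>\<close> by (intro young_function_mono[OF \<Psi>]) auto
    have "g / (K * a + \<epsilon> * k) \<le> g / (K * a)"
      using g \<open>0 < K\<close> \<open>0 < \<epsilon>\<close> by (intro divide_left_mono) (auto intro!: add_pos_pos mult_pos_pos)
    then have 2: "\<Psi> (g / (K * a + \<epsilon> * k)) \<le> \<Psi> (g / (K * a))"
      using g \<open>0 < K\<close> \<open>0 < \<epsilon>\<close> by (intro young_function_mono[OF \<Psi>]) auto
    consider "B \<le> g / k" | "g / (K * a) \<le> \<eta>" | "g / k < B" "\<eta> < g / (K * a)" by linarith
    then show ?thesis
    proof cases
      case 1
      then have "\<Psi> (g / (K * a + \<epsilon> * k)) \<le> \<Phi> (g / k) / 3"
        using B(2)[OF 1] \<open>\<Psi> (g / (K * a + \<epsilon> * k)) \<le> \<Psi> (1 / \<epsilon> * (g / k))\<close> by simp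
      then show ?thesis by (simp add: add_increasing add_increasing2)
    next
      case 2
      have "\<Psi> (g / (K * a)) \<le> \<Psi> \<eta>"
        using 2 g \<open>0 < K\<close> by (intro young_function_mono[OF \<Psi>]) auto
      then have "\<Psi> (g / (K * a + \<epsilon> * k)) \<le> 1 / 3"
        using \<eta> \<open>\<Psi> (g / (K * a + \<epsilon> * k)) \<le> \<Psi> (g / (K * a))\<close> by simp
      then show ?thesis using \<open>0 \<le> \<Phi> (g / k)\<close> zero_le_power2[of "g / a"] by linarith
    next
      case 3
      have "\<Psi> (1 / \<epsilon> * (g / k)) \<le> \<Psi> (1 / \<epsilon> * B)"
        using 3 g \<open>0 < \<epsilon>\<close> by (intro young_function_mono[OF \<Psi>] mult_left_mono) auto
      then have "\<Psi> (g / (K * a + \<epsilon> * k)) \<le> D"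
        using 1 by (simp add: D_def)
      moreover have "\<eta> * K \<le> g / a"
        using 3 g \<open>0 < K\<close> by (simp add: field_simps)
      then have "3 * D + 1 \<le> g / a"
        using \<eta> by (simp add: K_def)
      then have "3 * D + 1 \<le> (g / a)\<^sup>2"
        using \<open>0 \<le> D\<close> self_le_power[of "g / a" 2] by linarith
      ultimately show ?thesis using \<open>0 \<le> \<Phi> (g / k)\<close> by linarith
    qed
  qed
  then show ?thesis using that[OF \<open>0 < K\<close>] by simp
qed

text \<open>After integration each of the three summands contributes at most 1/3, so
  \<open>K * a + \<epsilon> * k\<close> is admissible for \<Psi>. The parameter \<open>k\<close> is
  any admissible value for \<Phi>, since the infimum itself might not be admissible.\<close>

lemma orlicz_norm_le_interpolation:
  fixes f :: "real \<Rightarrow> complex"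
  assumes \<Phi>: "nice_young_function \<Phi>" and cont: "continuous_on UNIV f"
    and pos: "0 < K" "0 < \<epsilon>" "0 < a" "0 < k"
    and L2: "(\<integral>\<^sup>+x\<in>{0..<1}. ennreal ((cmod (f x))\<^sup>2) \<partial>lborel) \<le> ennreal (a\<^sup>2)"
    and adm: "(\<integral>\<^sup>+x\<in>{0..<1}. ennreal (\<Phi> (cmod (f x) / k)) \<partial>lborel) \<le> 1"
    and pw: "\<And>g. 0 \<le> g \<Longrightarrow>
      \<Psi> (g / (K * a + \<epsilon> * k)) \<le> (g / a)\<^sup>2 / 3 + \<Phi> (g / k) / 3 + 1 / 3"
  shows "orlicz_norm \<Psi> f \<le> ennreal (K * a + \<epsilon> * k)"
proof -
  let ?I = "indicator {0..<1::real} :: real \<Rightarrow> ennreal"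
  \<comment> \<open>Continuity yields the measurability with which the integral of the sum is
    split.\<close>
  have "continuous_on UNIV (\<lambda>x. \<Phi> (cmod (f x) / k))"
  proof (rule continuous_on_compose2[where t = "{0..}" and g = \<Phi>])
    show "continuous_on UNIV (\<lambda>x. cmod (f x) / k)"
      using cont pos by (intro continuous_intros) auto
  qed (use \<Phi> pos in \<open>auto simp: nice_young_function_def\<close>)
  then have meas1 [measurable]: "(\<lambda>x. \<Phi> (cmod (f x) / k)) \<in> borel_measurable borel"
    by (rule borel_measurable_continuous_onI)
  have meas2 [measurable]: "f \<in> borel_measurable borel"
    using cont by (rule borel_measurable_continuous_onI)
  have nn: "0 \<le> \<Phi> (cmod (f x) / k)" for x
    using \<Phi> pos by (simp add: nice_young_function_def young_function_def)
  have "(\<integral>\<^sup>+x\<in>{0..<1}. ennreal (\<Psi> (cmod (f x) / (K * a + \<epsilon> * k))) \<partial>lborel)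
      \<le> (\<integral>\<^sup>+x. ennreal (1 / (3 * a\<^sup>2)) * (ennreal ((cmod (f x))\<^sup>2) * ?I x)
            + ennreal (1 / 3) * (ennreal (\<Phi> (cmod (f x) / k)) * ?I x)
            + ennreal (1 / 3) * ?I x \<partial>lborel)"
  proof (rule nn_integral_mono)
    fix x
    have "ennreal (\<Psi> (cmod (f x) / (K * a + \<epsilon> * k)))
        \<le> ennreal (1 / (3 * a\<^sup>2) * (cmod (f x))\<^sup>2 + 1 / 3 * \<Phi> (cmod (f x) / k) + 1 / 3)"
      using pw[of "cmod (f x)"] by (intro ennreal_leI) (simp add: power_divide)
    also have "\<dots> = ennreal (1 / (3 * a\<^sup>2)) * ennreal ((cmod (f x))\<^sup>2)
            + ennreal (1 / 3) * ennreal (\<Phi> (cmod (f x) / k)) + ennreal (1 / 3)"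
      using nn[of x] by (simp add: ennreal_plus ennreal_mult' del: times_divide_eq_left)
    finally show "ennreal (\<Psi> (cmod (f x) / (K * a + \<epsilon> * k))) * ?I x
      \<le> ennreal (1 / (3 * a\<^sup>2)) * (ennreal ((cmod (f x))\<^sup>2) * ?I x)
            + ennreal (1 / 3) * (ennreal (\<Phi> (cmod (f x) / k)) * ?I x)
            + ennreal (1 / 3) * ?I x"
      by (auto simp: indicator_def)
  qed
  also have "\<dots> = ennreal (1 / (3 * a\<^sup>2)) * (\<integral>\<^sup>+x\<in>{0..<1}. ennreal ((cmod (f x))\<^sup>2) \<partial>lborel)
        + ennreal (1 / 3) * (\<integral>\<^sup>+x\<in>{0..<1}. ennreal (\<Phi> (cmod (f x) / k)) \<partial>lborel)
        + ennreal (1 / 3)"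
    by (simp add: nn_integral_add nn_integral_cmult)
  also have "\<dots> \<le> ennreal (1 / (3 * a\<^sup>2)) * ennreal (a\<^sup>2) + ennreal (1 / 3) * 1 + ennreal (1 / 3)"
    using L2 adm by (intro add_mono mult_left_mono) auto
  also have "ennreal (1 / (3 * a\<^sup>2)) * ennreal (a\<^sup>2) = ennreal (1 / 3)"
    using pos by (simp flip: ennreal_mult')
  also have "ennreal (1 / 3) + ennreal (1 / 3) * 1 + ennreal (1 / 3) = 1"
    by (simp flip: ennreal_plus)
  finally have "(\<integral>\<^sup>+x\<in>{0..<1}. ennreal (\<Psi> (cmod (f x) / (K * a + \<epsilon> * k))) \<partial>lborel) \<le> 1" .
  moreover have "0 < K * a + \<epsilon> * k" using pos by (simp add: add_pos_pos)
  ultimately show ?thesis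
    unfolding orlicz_norm_def
    by (intro Inf_lower CollectI exI[of _ "K * a + \<epsilon> * k"] conjI) simp_all
qed

subsection \<open>Exponential sums\<close>

lemma exp_eq_cis: "exp (2 * of_real pi * \<i> * of_int n * of_real x) = cis (2 * pi * of_int n * x)"
  by (simp add: cis_conv_exp mult_ac)

lemma norm_exponential_sum_squared:
  "(cmod (\<Sum>n\<in>A. cis (\<theta> n)))\<^sup>2 = (\<Sum>n\<in>A. \<Sum>m\<in>A. cos (\<theta> n - \<theta> m))"
  unfolding cmod_power2
  by (simp add: power2_eq_square sum_product cos_diff sum.distrib)

text \<open>Parseval for exponential sums with unit coefficients, by an explicit antiderivative of
  the double cosine sum: off-diagonal terms cancel over a period, and each diagonal term gives
  1.\<close>

lemma nn_integral_exponential_sum_squared: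
  fixes A :: "int set"
  assumes "finite A"
  shows "(\<integral>\<^sup>+x\<in>{0..<1}. ennreal ((cmod (\<Sum>n\<in>A. cis (2 * pi * of_int n * x)))\<^sup>2) \<partial>lborel)
      = ennreal (card A)"
proof -
  let ?f = "\<lambda>x. (cmod (\<Sum>n\<in>A. cis (2 * pi * of_int n * x)))\<^sup>2"
  define G where "G d x = (if d = 0 then x else sin (2 * pi * of_int d * x) / (2 * pi * of_int d))"
    for d :: int and x :: real
  define F where "F x = (\<Sum>n\<in>A. \<Sum>m\<in>A. G (n - m) x)" for x
  have G: "(G d has_real_derivative cos (2 * pi * of_int d * x)) (at x within T)" for d x T
    unfolding G_def[abs_def] by (cases "d = 0") (auto intro!: derivative_eq_intros)
  have diff: "2 * pi * of_int n * x - 2 * pi * of_int m * x = 2 * pi * of_int (n - m) * x"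
    for n m :: int and x :: real
    by (simp add: algebra_simps)
  have "(F has_real_derivative ?f x) (at x within T)" for x T
    unfolding F_def[abs_def] norm_exponential_sum_squared
    by (intro DERIV_sum) (simp only: diff G)
  moreover have "?f \<in> borel_measurable borel"
    by (intro borel_measurable_continuous_onI continuous_intros)
  ultimately have "(\<integral>\<^sup>+x\<in>{0..1}. ennreal (?f x) \<partial>lborel) = ennreal (F 1 - F 0)"
    by (intro nn_integral_FTC_Icc) auto
  moreover have "F 1 - F 0 = card A"
  proof -
    have "G d 1 - G d 0 = (if d = 0 then 1 else 0)" for d
      using sin_integer_2pi[of "of_int d"] by (auto simp: G_def)
    then have "F 1 - F 0 = (\<Sum>n\<in>A. \<Sum>m\<in>A. if n = m then 1 else 0)"
      by (simp add: F_def flip: sum_subtractf)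
    also have "\<dots> = card A" using assms by (simp add: sum.delta)
    finally show ?thesis .
  qed
  \<comment> \<open>The fundamental theorem gives the closed interval, which differs from the period
    by a null set.\<close>
  moreover have "(\<integral>\<^sup>+x\<in>{0..<1}. ennreal (?f x) \<partial>lborel) = (\<integral>\<^sup>+x\<in>{0..1}. ennreal (?f x) \<partial>lborel)"
    using AE_lborel_singleton[of 1]
    by (intro nn_integral_cong_AE) (auto elim!: eventually_mono simp: indicator_def)
  ultimately show ?thesis by simp
qed

text \<open>So close to 0 every phase is at most pi/3 in absolute value; each term has real part at
  least 1/2 and nothing cancels.\<close>

lemma norm_exponential_sum_ge:
  fixes A :: "int set" and N :: int
  assumes "A \<subseteq> {-N..N}" "0 < N" "0 \<le> x" "x \<le> 1 / (6 * of_int N)"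
  shows "card A / 2 \<le> cmod (\<Sum>n\<in>A. cis (2 * pi * of_int n * x))"
proof -
  have "1 / 2 \<le> cos (2 * pi * of_int n * x)" if "n \<in> A" for n
  proof -
    have "\<bar>real_of_int n\<bar> \<le> of_int N" using assms that by force
    then have "\<bar>of_int n\<bar> * x \<le> of_int N * (1 / (6 * of_int N))"
      using assms by (intro mult_mono) auto
    then have "\<bar>of_int n\<bar> * x \<le> 1 / 6" using assms by simp
    then have "2 * pi * (\<bar>of_int n\<bar> * x) \<le> 2 * pi * (1 / 6)"
      by (intro mult_left_mono) auto
    then have "\<bar>2 * pi * of_int n * x\<bar> \<le> pi / 3"
      using assms by (simp add: abs_mult mult.assoc)
    then have "cos (pi / 3) \<le> cos \<bar>2 * pi * of_int n * x\<bar>"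
      by (intro cos_monotone_0_pi_le) auto
    then show ?thesis by (simp add: cos_60 del: abs_mult)
  qed
  then have "(\<Sum>n\<in>A. 1 / 2) \<le> (\<Sum>n\<in>A. cos (2 * pi * of_int n * x))"
    by (rule sum_mono)
  also have "\<dots> = Re (\<Sum>n\<in>A. cis (2 * pi * of_int n * x))" by simp
  also have "\<dots> \<le> cmod (\<Sum>n\<in>A. cis (2 * pi * of_int n * x))" by (rule complex_Re_le_cmod)
  finally show ?thesis by simp
qed

lemma trig_poly_indicator:
  assumes "A \<subseteq> S"
  shows "trig_poly S (\<lambda>n. if n \<in> A then 1 else 0) x = (\<Sum>n\<in>A. cis (2 * pi * of_int n * x))"
proof -
  have "{n \<in> S. (if n \<in> A then 1 else 0 :: complex) \<noteq> 0} = A" using assms by auto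
  then show ?thesis by (simp add: trig_poly_def exp_eq_cis)
qed

text \<open>On an interval of length \<open>1 / (6 * N)\<close> the sum is at least
  \<open>card A / 2\<close>. With \<open>w = card A / (2 * k)\<close>, admissibility of
  \<open>k\<close> therefore forces \<open>\<Phi> w \<le> 6 * N\<close>.\<close>

lemma card_le_of_admissible:
  fixes A :: "int set" and N :: int
  assumes \<Phi>: "nice_young_function \<Phi>" and A: "A \<subseteq> {-N..N}" "0 < N" and "0 < k"
    and adm: "(\<integral>\<^sup>+x\<in>{0..<1}. ennreal (\<Phi> (cmod (\<Sum>n\<in>A. cis (2 * pi * of_int n * x)) / k)) \<partial>lborel) \<le> 1"
  shows "card A \<le> 12 * k * young_inverse \<Phi> (of_int N)"
proof -
  have Y: "young_function \<Phi>" using \<Phi> by (simp add: nice_young_function_def)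
  let ?J = "{0..1 / (6 * of_int N)} :: real set"
  have N: "1 \<le> real_of_int N" using A by simp
  define w where "w = card A / 2 / k"
  have "0 \<le> w" using \<open>0 < k\<close> by (simp add: w_def)
  have "0 \<le> \<Phi> w" using Y \<open>0 \<le> w\<close> by (simp add: young_function_def)
  have "ennreal (\<Phi> w * (1 / (6 * of_int N))) = ennreal (\<Phi> w) * emeasure lborel ?J"
    using N \<open>0 \<le> \<Phi> w\<close> by (simp add: ennreal_mult' del: times_divide_eq_right)
  also have "\<dots> = (\<integral>\<^sup>+x. ennreal (\<Phi> w) * indicator ?J x \<partial>lborel)"
    by (rule nn_integral_cmult_indicator[symmetric]) simp
  also have "\<dots> \<le> (\<integral>\<^sup>+x\<in>{0..<1}. ennreal (\<Phi> (cmod (\<Sum>n\<in>A. cis (2 * pi * of_int n * x)) / k)) \<partial>lborel)"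
  proof (rule nn_integral_mono)
    fix x
    show "ennreal (\<Phi> w) * indicator ?J x
      \<le> ennreal (\<Phi> (cmod (\<Sum>n\<in>A. cis (2 * pi * of_int n * x)) / k)) * indicator {0..<1} x"
    proof (cases "x \<in> ?J")
      case True
      moreover have "1 / (6 * real_of_int N) < 1" using N by simp
      ultimately have "x \<in> {0..<1}" by auto
      have "w \<le> cmod (\<Sum>n\<in>A. cis (2 * pi * of_int n * x)) / k"
        unfolding w_def using A True \<open>0 < k\<close>
        by (intro divide_right_mono norm_exponential_sum_ge) auto
      then have "\<Phi> w \<le> \<Phi> (cmod (\<Sum>n\<in>A. cis (2 * pi * of_int n * x)) / k)"
        using \<open>0 \<le> w\<close> by (intro young_function_mono[OF Y])
      then show ?thesis using True \<open>x \<in> {0..<1}\<close> by (simp add: ennreal_leI)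
    qed simp
  qed
  also note adm
  finally have "\<Phi> w / 6 \<le> of_int N" using N by (simp add: field_simps)
  \<comment> \<open>Convexity moves the factor 1/6 inside \<Phi>; together with the 2 in
    \<open>w\<close> it produces the constant 12.\<close>
  then have "\<Phi> (1 / 6 * w) \<le> of_int N"
    using young_function_scale_le[OF Y, of "1 / 6" w] \<open>0 \<le> w\<close> by simp
  then have "1 / 6 * w \<le> young_inverse \<Phi> (of_int N)"
    using \<open>0 \<le> w\<close> by (intro le_young_inverse[OF \<Phi>]) auto
  then show ?thesis using \<open>0 < k\<close> by (simp add: w_def field_simps)
qed

section \<open>Finiteness of the norm, absorption and conclusion\<close>

text \<open>Absorbing a multiple of the norm into the left-hand side is meaningful only for a finite
  norm. Here \<open>m / u\<close> with \<open>\<Phi> u \<le> 1\<close> is admissible.\<close>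

lemma orlicz_norm_bounded_finite:
  fixes f :: "real \<Rightarrow> complex"
  assumes \<Phi>: "young_function \<Phi>" and "0 < m" and le: "\<And>x. cmod (f x) \<le> m"
  shows "orlicz_norm \<Phi> f < \<infinity>"
proof -
  obtain u where u: "0 < u" "\<Phi> u \<le> 1"
    using young_function_small[OF \<Phi> zero_less_one] by blast
  have "\<Phi> (cmod (f x) / (m / u)) \<le> 1" for x
  proof -
    have "cmod (f x) / (m / u) \<le> u" using le[of x] u \<open>0 < m\<close> by (simp add: field_simps)
    then have "\<Phi> (cmod (f x) / (m / u)) \<le> \<Phi> u"
      using u \<open>0 < m\<close> by (intro young_function_mono[OF \<Phi>]) auto
    then show ?thesis using u by simp
  qed
  then have "(\<integral>\<^sup>+x\<in>{0..<1}. ennreal (\<Phi> (cmod (f x) / (m / u))) \<partial>lborel)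
      \<le> (\<integral>\<^sup>+x. indicator {0..<1} x \<partial>(lborel :: real measure))"
    by (intro nn_integral_mono) (auto simp: indicator_def ennreal_le_1)
  then have "(\<integral>\<^sup>+x\<in>{0..<1}. ennreal (\<Phi> (cmod (f x) / (m / u))) \<partial>lborel) \<le> 1"
    by simp
  then have "orlicz_norm \<Phi> f \<le> ennreal (m / u)"
    unfolding orlicz_norm_def using u \<open>0 < m\<close>
    by (intro Inf_lower CollectI exI[of _ "m / u"] conjI) simp_all
  also have "\<dots> < \<infinity>" by simp
  finally show ?thesis .
qed

text \<open>
  The norm itself is at most \<open>2 * b\<close>; the factor \<open>4\<close> leaves room because the infimum defining it
  is not known to be attained.
\<close>

lemma orlicz_norm_absorb:
  assumes "orlicz_norm \<Phi> f < \<infinity>" "0 < b"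
    and bound: "\<And>k. 0 < k \<Longrightarrow> (\<integral>\<^sup>+x\<in>{0..<1}. ennreal (\<Phi> (cmod (f x) / k)) \<partial>lborel) \<le> 1 \<Longrightarrow>
      orlicz_norm \<Phi> f \<le> ennreal (b + k / 2)"
  obtains k where "0 < k" "k < 4 * b"
    "(\<integral>\<^sup>+x\<in>{0..<1}. ennreal (\<Phi> (cmod (f x) / k)) \<partial>lborel) \<le> 1"
proof -
  have Inf_lessD: "\<exists>k>0. (\<integral>\<^sup>+x\<in>{0..<1}. ennreal (\<Phi> (cmod (f x) / k)) \<partial>lborel) \<le> 1 \<and> k < y"
    if less: "orlicz_norm \<Phi> f < ennreal y" for y
  proof -
    obtain k where k: "0 < k" "ennreal k < ennreal y"
      "(\<integral>\<^sup>+x\<in>{0..<1}. ennreal (\<Phi> (cmod (f x) / k)) \<partial>lborel) \<le> 1"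
      using less unfolding orlicz_norm_def Inf_less_iff by auto
    then have "k < y" by (simp add: ennreal_less_iff)
    then show ?thesis using k(1,3) by (intro exI[of _ k] conjI)
  qed
  obtain r where r: "0 \<le> r" "orlicz_norm \<Phi> f = ennreal r"
    using assms(1) by (cases "orlicz_norm \<Phi> f") auto
  show ?thesis
  proof (cases "r < 4 * b")
    case True
    then have "orlicz_norm \<Phi> f < ennreal (4 * b)" using r by (simp add: ennreal_less_iff)
    then show ?thesis using Inf_lessD[of "4 * b"] that by meson
  next
    case False
    \<comment> \<open>If \<open>r \<ge> 4 * b\<close>, some admissible \<open>k\<close> lies below
      \<open>2 * (r - b)\<close>, and the bound yields \<open>r \<le> b + k / 2 < r\<close>, a
      contradiction.\<close>
    then have "r < 2 * (r - b)" using \<open>0 < b\<close> by simp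
    then have "orlicz_norm \<Phi> f < ennreal (2 * (r - b))" using r by (simp add: ennreal_less_iff)
    then obtain k where k: "0 < k" "k < 2 * (r - b)"
      "(\<integral>\<^sup>+x\<in>{0..<1}. ennreal (\<Phi> (cmod (f x) / k)) \<partial>lborel) \<le> 1"
      using Inf_lessD[of "2 * (r - b)"] by meson
    then have "ennreal r \<le> ennreal (b + k / 2)" using bound[of k] r by simp
    then have "r \<le> b + k / 2" using k \<open>0 < b\<close> by (subst (asm) ennreal_le_iff) auto
    then show ?thesis using k by simp
  qed
qed

theorem theorem1p4:
  fixes \<Phi> :: "real \<Rightarrow> real" and S :: "int set"
  assumes "nice_young_function \<Phi>"
    and "matuszewska_orlicz_alpha \<Phi> > 2"
    and "Lambda_set \<Phi> S"
  shows "\<exists>C>0. \<forall>N::int. N \<ge> 1 \<longrightarrow>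
           real (card (S \<inter> {-N..N})) \<le> C * (young_inverse \<Phi> (of_int N))\<^sup>2"
proof -
  obtain \<Psi> C' where \<Psi>: "nice_young_function \<Psi>"
    and idx: "matuszewska_orlicz_beta \<Psi> < matuszewska_orlicz_alpha \<Phi>" and "C' > 0"
    and norm: "\<And>a. finite {n \<in> S. a n \<noteq> 0} \<Longrightarrow>
      orlicz_norm \<Phi> (trig_poly S a) \<le> ennreal C' * orlicz_norm \<Psi> (trig_poly S a)"
    using assms(3) unfolding Lambda_set_def by blast
  \<comment> \<open>With this choice \<open>C' * \<epsilon> * k = k / 2\<close>, the share that can
    be absorbed.\<close>
  define \<epsilon> where "\<epsilon> = 1 / (2 * C')"
  have "0 < \<epsilon>" using \<open>C' > 0\<close> by (simp add: \<epsilon>_def)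
  have Y: "young_function \<Phi>" "young_function \<Psi>"
    using assms(1) \<Psi> by (auto simp: nice_young_function_def)
  have "0 < matuszewska_orlicz_alpha \<Phi>"
    using assms(2) by (rule less_trans[rotated]) simp
  then have "eventually (\<lambda>u. \<Psi> (1 / \<epsilon> * u) \<le> 1 / 3 * \<Phi> u) at_top"
    using \<open>0 < \<epsilon>\<close> by (intro eventually_dilate_le_of_indices[OF assms(1) \<Psi> idx]) auto
  then obtain K where "0 < K" and pw: "\<And>g a k. 0 \<le> g \<Longrightarrow> 0 < a \<Longrightarrow> 0 < k \<Longrightarrow>
      \<Psi> (g / (K * a + \<epsilon> * k)) \<le> (g / a)\<^sup>2 / 3 + \<Phi> (g / k) / 3 + 1 / 3"
    using young_function_interpolation[OF Y \<open>0 < \<epsilon>\<close>] by blast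
  \<comment> \<open>48 is the 12 from \<open>card_le_of_admissible\<close> times the 4 from
    \<open>orlicz_norm_absorb\<close>.\<close>
  define C where "C = (48 * C' * K)\<^sup>2"
  have "0 < C" using \<open>0 < K\<close> \<open>C' > 0\<close> by (simp add: C_def)
  moreover have "real (card (S \<inter> {-N..N})) \<le> C * (young_inverse \<Phi> (of_int N))\<^sup>2"
    if "N \<ge> 1" for N :: int
  proof (cases "S \<inter> {-N..N} = {}")
    case True
    then show ?thesis using \<open>0 < C\<close> by simp
  next
    case False
    define A where "A = S \<inter> {-N..N}"
    have A: "finite A" "A \<subseteq> S" "A \<subseteq> {-N..N}" by (auto simp: A_def)
    have m: "0 < real (card A)" using False A by (simp add: A_def card_gt_0_iff)
    \<comment> \<open>This is the exact L2 norm of the sum; it is positive because the empty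
      intersection was split off.\<close>
    define \<sigma> where "\<sigma> = sqrt (card A)"
    have \<sigma>: "0 < \<sigma>" "\<sigma>\<^sup>2 = card A" using m by (auto simp: \<sigma>_def)
    define f where "f x = (\<Sum>n\<in>A. cis (2 * pi * of_int n * x))" for x :: real
    have f: "trig_poly S (\<lambda>n. if n \<in> A then 1 else 0) = f"
      using trig_poly_indicator[OF \<open>A \<subseteq> S\<close>] by (simp add: f_def fun_eq_iff)
    have "{n \<in> S. (if n \<in> A then 1 else 0 :: complex) \<noteq> 0} = A" using A by auto
    then have Lambda: "orlicz_norm \<Phi> f \<le> ennreal C' * orlicz_norm \<Psi> f"
      using norm[of "\<lambda>n. if n \<in> A then 1 else 0"] A f by simp
    have cont: "continuous_on UNIV f"
      unfolding f_def[abs_def] by (intro continuous_intros)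
    have "cmod (f x) \<le> card A" for x
      unfolding f_def by (rule order_trans[OF norm_sum]) simp
    then have finite: "orlicz_norm \<Phi> f < \<infinity>"
      using m by (intro orlicz_norm_bounded_finite[OF Y(1)])
    have bound: "orlicz_norm \<Phi> f \<le> ennreal (C' * K * \<sigma> + k / 2)"
      if k: "0 < k" "(\<integral>\<^sup>+x\<in>{0..<1}. ennreal (\<Phi> (cmod (f x) / k)) \<partial>lborel) \<le> 1" for k
    proof -
      have "(\<integral>\<^sup>+x\<in>{0..<1}. ennreal ((cmod (f x))\<^sup>2) \<partial>lborel) \<le> ennreal (\<sigma>\<^sup>2)"
        unfolding f_def nn_integral_exponential_sum_squared[OF A(1)] \<sigma>(2) by simp
      then have "orlicz_norm \<Psi> f \<le> ennreal (K * \<sigma> + \<epsilon> * k)"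
        using \<open>0 < K\<close> \<open>0 < \<epsilon>\<close> \<sigma> k pw
        by (intro orlicz_norm_le_interpolation[OF assms(1) cont]) auto
      then have "ennreal C' * orlicz_norm \<Psi> f \<le> ennreal C' * ennreal (K * \<sigma> + \<epsilon> * k)"
        by (rule mult_left_mono) simp
      also have "\<dots> = ennreal (C' * (K * \<sigma> + \<epsilon> * k))"
        using \<open>C' > 0\<close> by (simp add: ennreal_mult')
      also have "C' * (K * \<sigma> + \<epsilon> * k) = C' * K * \<sigma> + k / 2"
        using \<open>C' > 0\<close> by (simp add: \<epsilon>_def field_simps)
      finally show ?thesis using Lambda by (rule order_trans[rotated])
    qed
    have "0 < C' * K * \<sigma>" using \<open>0 < K\<close> \<open>C' > 0\<close> \<sigma> by simp
    then obtain k where k: "0 < k" "k < 4 * (C' * K * \<sigma>)"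
      "(\<integral>\<^sup>+x\<in>{0..<1}. ennreal (\<Phi> (cmod (f x) / k)) \<partial>lborel) \<le> 1"
      using orlicz_norm_absorb[OF finite _ bound] by blast
    define y where "y = young_inverse \<Phi> (of_int N)"
    have "\<sigma>\<^sup>2 \<le> 12 * k * y"
      using card_le_of_admissible[OF assms(1) A(3) _ k(1)] k(3) \<open>N \<ge> 1\<close> \<sigma>
      by (simp add: f_def y_def)
    moreover have "0 \<le> y"
      unfolding y_def using \<open>N \<ge> 1\<close> Y(1)
      by (intro le_young_inverse[OF assms(1)]) (auto simp: young_function_def)
    then have "12 * k * y \<le> 12 * (4 * (C' * K * \<sigma>)) * y"
      using k by (intro mult_right_mono mult_left_mono) auto
    ultimately have "\<sigma>\<^sup>2 \<le> 12 * (4 * (C' * K * \<sigma>)) * y" by simp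
    \<comment> \<open>Cancelling one factor \<sigma> bounds the square root of the cardinality
      linearly in \<open>y\<close>; squaring produces the square of the inverse function.\<close>
    then have "\<sigma> \<le> 48 * C' * K * y"
      using \<sigma> by (simp add: power2_eq_square mult_ac)
    then have "\<sigma>\<^sup>2 \<le> (48 * C' * K * y)\<^sup>2" using \<sigma> by (intro power_mono) auto
    then show ?thesis
      using \<sigma> by (simp add: C_def y_def A_def power_mult_distrib)
  qed
  ultimately show ?thesis by blast
qed

end
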